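(* Let $\mathcal{C}_4=\mathbb{C}\{e_1,e_2,e_3,e_4\}$ be the complex Clifford algebra with generators satisfying $e_j^2=-1$ and $e_je_k=-e_ke_j$ ($j\ne k$), of dimension $16$, and let $\mathcal{C}_2\subset\mathcal{C}_4$ be the subalgebra with basis $1,e_1,e_2,e_{12}=e_1e_2$. Let $e_{123}=e_1e_2e_3$ (also written $e_{[3]}$), $e_{124}=e_1e_2e_4$, $e_{43}=e_4e_3$; then $e_{123}^2=e_{124}^2=1$ and $e_{43}=e_{123}e_{124}=-e_{124}e_{123}$. Every $a\in\mathcal{C}_4$ can be written as $$a=a_0+a_1e_{123}+a_2e_{124}+a_3e_{43}=a_0+e_{123}a_1+e_{124}a_2+e_{43}a_3$$ with $a_0,a_1,a_2,a_3\in\mathcal{C}_2$. Let $$P_2=\frac12\begin{pmatrix}1-ie_1 & e_2+ie_{12}\\ -e_2+ie_{12} & 1+ie_1\end{pmatrix},\qquad P_4=\frac12\begin{pmatrix}(1+e_{[3]})P_2 & (e_{124}-e_{43})P_2\\ (e_{124}+e_{43})P_2 & (1-e_{[3]})P_2\end{pmatrix}.$$ Then $P_4$ is invertible with $P_4^{-1}=P_4$, and $$P_4(aI_4)P_4^{-1}=\begin{pmatrix}\phi_2(a_0)+\phi_2(a_1) & \phi_2(a_2)+\phi_2(a_3)\\ \phi_2(a_2)-\phi_2(a_3) & \phi_2(a_0)-\phi_2(a_1)\end{pmatrix}\in\mathbb{C}^{4\times 4}.$$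
   Context: For $b=b_0+b_1e_1+b_2e_2+b_3e_{12}\in\mathcal{C}_2$ ($b_j\in\mathbb{C}$), $\phi_2(b)=\begin{pmatrix}b_0+b_1i & -(b_2+b_3i)\\ b_2-b_3i & b_0-b_1i\end{pmatrix}\in\mathbb{C}^{2\times2}$. $i$ is the imaginary unit of $\mathbb{C}$. For an element $c$ and a matrix $M$, $cM$ denotes the matrix with entries $cM_{jk}$. *)

theory Defs
  imports Complex_Main
begin

text \<open>An element is given by its 16 complex coefficients on the basis blades
  e_A, A a subset of {1,2,3,4} (e_A = e_{a1} e_{a2} ... with a1 < a2 < ...).\<close>

typedef cl4 = "{f :: nat set \<Rightarrow> complex. \<forall>A. \<not> A \<subseteq> {1..4} \<longrightarrow> f A = 0}"
  by (rule exI[of _ "\<lambda>_. 0"]) simp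

definition mk :: "(nat set \<Rightarrow> complex) \<Rightarrow> cl4" where
  "mk f = Abs_cl4 (\<lambda>A. if A \<subseteq> {1..4} then f A else 0)"

abbreviation coeff :: "cl4 \<Rightarrow> nat set \<Rightarrow> complex" where
  "coeff \<equiv> Rep_cl4"

text \<open>Sign in e_A e_B = sign(A,B) e_{A \<triangle> B}: one factor -1 per inversion, and
  one factor -1 per common generator (since e_j^2 = -1).\<close>
definition blade_sign :: "nat set \<Rightarrow> nat set \<Rightarrow> complex" where
  "blade_sign A B = (-1) ^ card {(a, b). a \<in> A \<and> b \<in> B \<and> b < a} * (-1) ^ card (A \<inter> B)"

instantiation cl4 :: "{zero, one, plus, minus, uminus, times}"
begin
definition "0 = mk (\<lambda>_. 0)"
definition "1 = mk (\<lambda>A. if A = {} then 1 else 0)"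
definition "x + y = mk (\<lambda>A. coeff x A + coeff y A)"
definition "x - y = mk (\<lambda>A. coeff x A - coeff y A)"
definition "- x = mk (\<lambda>A. - coeff x A)"
definition "x * y = mk (\<lambda>C. \<Sum>A\<in>Pow {1..4}. \<Sum>B\<in>Pow {1..4}.
      if (A - B) \<union> (B - A) = C then blade_sign A B * coeff x A * coeff y B else 0)"
instance ..
end

definition scal :: "complex \<Rightarrow> cl4" where
  "scal c = mk (\<lambda>A. if A = {} then c else 0)"

definition smul :: "complex \<Rightarrow> cl4 \<Rightarrow> cl4" where
  "smul c x = mk (\<lambda>A. c * coeff x A)"

definition gen :: "nat \<Rightarrow> cl4" where
  "gen j = mk (\<lambda>A. if A = {j} then 1 else 0)"

definition e12 :: cl4 where "e12 = gen 1 * gen 2"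
definition e123 :: cl4 where "e123 = gen 1 * gen 2 * gen 3"
definition e124 :: cl4 where "e124 = gen 1 * gen 2 * gen 4"
definition e43 :: cl4 where "e43 = gen 4 * gen 3"

definition C2 :: "cl4 set" where
  "C2 = {x. \<forall>A. \<not> A \<subseteq> {1, 2} \<longrightarrow> coeff x A = 0}"

definition phi2 :: "cl4 \<Rightarrow> nat \<Rightarrow> nat \<Rightarrow> complex" where
  "phi2 b i j =
     (let b0 = coeff b {}; b1 = coeff b {1}; b2 = coeff b {2}; b3 = coeff b {1, 2} in
      if i = 0 \<and> j = 0 then b0 + b1 * \<i>
      else if i = 0 \<and> j = 1 then - (b2 + b3 * \<i>)
      else if i = 1 \<and> j = 0 then b2 - b3 * \<i>
      else if i = 1 \<and> j = 1 then b0 - b1 * \<i>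
      else 0)"

type_synonym cmat = "nat \<Rightarrow> nat \<Rightarrow> cl4"

definition mmult :: "cmat \<Rightarrow> cmat \<Rightarrow> cmat" where
  "mmult M N = (\<lambda>i j. M i 0 * N 0 j + M i 1 * N 1 j + M i 2 * N 2 j + M i 3 * N 3 j)"

definition diag4 :: "cl4 \<Rightarrow> cmat" where
  "diag4 a = (\<lambda>i j. if i = j then a else 0)"

abbreviation I4 :: cmat where "I4 \<equiv> diag4 1"

definition invertible4 :: "cmat \<Rightarrow> bool" where
  "invertible4 M \<longleftrightarrow> (\<exists>N. \<forall>i<4. \<forall>j<4. mmult M N i j = I4 i j \<and> mmult N M i j = I4 i j)"

definition P2 :: "nat \<Rightarrow> nat \<Rightarrow> cl4" where
  "P2 i j = smul (1/2)
     (if i = 0 \<and> j = 0 then 1 - smul \<i> (gen 1)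
      else if i = 0 \<and> j = 1 then gen 2 + smul \<i> e12
      else if i = 1 \<and> j = 0 then - gen 2 + smul \<i> e12
      else 1 + smul \<i> (gen 1))"

definition B4 :: "nat \<Rightarrow> nat \<Rightarrow> cl4" where
  "B4 p q =
     (if p = 0 \<and> q = 0 then 1 + e123
      else if p = 0 \<and> q = 1 then e124 - e43
      else if p = 1 \<and> q = 0 then e124 + e43
      else 1 - e123)"

definition P4 :: cmat where
  "P4 = (\<lambda>i j. smul (1/2) (B4 (i div 2) (j div 2) * P2 (i mod 2) (j mod 2)))"

definition rhs4 :: "cl4 \<Rightarrow> cl4 \<Rightarrow> cl4 \<Rightarrow> cl4 \<Rightarrow> nat \<Rightarrow> nat \<Rightarrow> complex" where
  "rhs4 a0 a1 a2 a3 i j =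
     (let u = i mod 2; v = j mod 2 in
      if i div 2 = 0 \<and> j div 2 = 0 then phi2 a0 u v + phi2 a1 u v
      else if i div 2 = 0 \<and> j div 2 = 1 then phi2 a2 u v + phi2 a3 u v
      else if i div 2 = 1 \<and> j div 2 = 0 then phi2 a2 u v - phi2 a3 u v
      else phi2 a0 u v - phi2 a1 u v)"

end

theory Submission
  imports Defs
begin

text \<open>
  The elements \<open>e123\<close> and \<open>e124\<close> are anticommuting involutions that commute with
  \<open>C2\<close>. Hence for \<open>E\<close> among \<open>1, e123, e124, e43\<close> and \<open>b\<close> in \<open>C2\<close>, every entry of
  \<open>P4 (E b I) P4\<close> factors as \<open>1/4\<close> times a sum over the outer blocks, which involves only \<open>E\<close> and
  is \<open>0\<close> or \<open>\<plusminus>4\<close>, times an entry of \<open>P2 (b I) P2\<close>, which is \<open>phi2 b\<close>. That \<open>P4\<close> is an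
  involution is the case \<open>a = 1\<close>. Associativity holds because the sign of a product of blades is a
  bicharacter for the symmetric difference, hence a 2-cocycle.
\<close>

section \<open>The Clifford algebra as a ring\<close>

lemma coeff_outside: "\<not> A \<subseteq> {1..4} \<Longrightarrow> coeff x A = 0"
  using Rep_cl4[of x] by simp

lemma coeff_mk: "coeff (mk f) A = (if A \<subseteq> {1..4} then f A else 0)"
  unfolding mk_def by (subst Abs_cl4_inverse) auto

lemma cl4_eqI: "(\<And>A. A \<subseteq> {1..4} \<Longrightarrow> coeff x A = coeff y A) \<Longrightarrow> x = y"
  by (metis Rep_cl4_inject coeff_outside ext)

lemma coeff_0: "coeff 0 A = 0"
  by (simp add: zero_cl4_def coeff_mk)

lemma coeff_add: "coeff (x + y) A = coeff x A + coeff y A"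
  by (simp add: plus_cl4_def coeff_mk coeff_outside)

lemma coeff_diff: "coeff (x - y) A = coeff x A - coeff y A"
  by (simp add: minus_cl4_def coeff_mk coeff_outside)

lemma coeff_uminus: "coeff (- x) A = - coeff x A"
  by (simp add: uminus_cl4_def coeff_mk coeff_outside)

lemma coeff_smul: "coeff (smul c x) A = c * coeff x A"
  by (simp add: smul_def coeff_mk coeff_outside)

section \<open>The blade sign as a bicharacter\<close>

text \<open>Pairs with \<open>b < a\<close> account for the inversions and pairs with
  \<open>b = a\<close> for the common generators, so one condition \<open>b \<le> a\<close> covers
  both. The product form exposes multiplicativity in each argument and makes signs of concrete
  blades computable by simplification.\<close>

lemma blade_sign_eq_prod:
  assumes "finite A" "finite B"
  shows "blade_sign A B = (\<Prod>a\<in>A. \<Prod>b\<in>B. if b \<le> a then -1 else 1)"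
proof -
  let ?L = "{(a, b). a \<in> A \<and> b \<in> B \<and> b < a}" and ?E = "(\<lambda>a. (a, a)) ` (A \<inter> B)"
  have fin: "finite ?L" "finite ?E"
    using assms by (auto intro: finite_subset[of _ "A \<times> B"])
  have "(\<Prod>a\<in>A. \<Prod>b\<in>B. if b \<le> a then -1 else 1 :: complex)
      = (\<Prod>p\<in>A \<times> B. if snd p \<le> fst p then -1 else 1)"
    by (simp add: prod.cartesian_product case_prod_beta)
  also have "\<dots> = (\<Prod>p\<in>?L \<union> ?E. -1)"
    using assms by (intro prod.mono_neutral_cong_right) auto
  also have "\<dots> = (-1) ^ (card ?L + card ?E)"
    using fin by (subst card_Un_disjoint[symmetric]) auto
  also have "card ?E = card (A \<inter> B)"
    by (rule card_image) (simp add: inj_on_def)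
  finally show ?thesis
    by (simp add: blade_sign_def power_add)
qed

text \<open>The factors over \<open>A \<inter> B\<close> occur twice in the right-hand product and
  cancel, since each squares to 1.\<close>

lemma prod_sym_diff:
  fixes f :: "'a \<Rightarrow> 'b :: comm_monoid_mult"
  assumes "finite A" "finite B" and sq: "\<And>x. f x * f x = 1"
  shows "prod f (sym_diff A B) = prod f A * prod f B"
proof -
  have "prod f (sym_diff A B) = prod f (A - B) * prod f (B - A)"
    using assms by (intro prod.union_disjoint) auto
  moreover have "prod f A = prod f (A - B) * prod f (A \<inter> B)"
    using assms by (metis Int_Diff_disjoint Int_Diff_Un finite_Diff finite_Int mult.commute prod.union_disjoint)
  moreover have "prod f B = prod f (B - A) * prod f (A \<inter> B)"
    using assms by (metis Int_Diff_disjoint Int_Diff_Un Int_commute finite_Diff finite_Int mult.commute prod.union_disjoint)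
  moreover have "prod f (A \<inter> B) * prod f (A \<inter> B) = 1"
    by (simp add: sq flip: prod.distrib)
  ultimately show ?thesis
    by (simp add: ac_simps)
qed

lemma blade_sign_sym_diff_left:
  assumes "finite A" "finite B" "finite C"
  shows "blade_sign (sym_diff A B) C = blade_sign A C * blade_sign B C"
proof -
  \<comment> \<open>For fixed \<open>a\<close> the product over \<open>C\<close> is itself a sign;
    this is the squaring condition that \<open>prod_sym_diff\<close> asks for.\<close>
  have "(\<Prod>b\<in>C. if b \<le> a then -1 else 1) * (\<Prod>b\<in>C. if b \<le> a then -1 else 1) = (1 :: complex)" for a
    unfolding prod.distrib[symmetric] by (rule prod.neutral) simp
  with assms show ?thesis
    by (simp add: blade_sign_eq_prod prod_sym_diff)
qed

lemma blade_sign_sym_diff_right: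
  assumes "finite A" "finite B" "finite C"
  shows "blade_sign A (sym_diff B C) = blade_sign A B * blade_sign A C"
  using assms by (simp add: blade_sign_eq_prod prod_sym_diff prod.distrib)

section \<open>Coefficients of products and associativity\<close>

text \<open>Symmetric difference is a group law, so \<open>A\<close> and \<open>C\<close> determine
  the only \<open>B\<close> that contributes, and the inner sum collapses.\<close>

lemma coeff_mult:
  assumes "C \<subseteq> {1..4}"
  shows "coeff (x * y) C = (\<Sum>A\<in>Pow {1..4}.
           blade_sign A (sym_diff A C) * coeff x A * coeff y (sym_diff A C))"
proof -
  have "(\<Sum>B\<in>Pow {1..4}. if sym_diff A B = C then blade_sign A B * coeff x A * coeff y B else 0)
      = blade_sign A (sym_diff A C) * coeff x A * coeff y (sym_diff A C)"
    if "A \<in> Pow {1..4}" for A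
  proof -
    have "sym_diff A B = C \<longleftrightarrow> B = sym_diff A C" for B by blast
    moreover have "sym_diff A C \<in> Pow {1..4}" using that assms by blast
    ultimately show ?thesis by simp
  qed
  then show ?thesis
    using assms by (simp add: times_cl4_def coeff_mk)
qed

lemma cl4_mult_assoc:
  fixes x y z :: cl4
  shows "x * y * z = x * (y * z)"
proof (rule cl4_eqI)
  fix D :: "nat set" assume D: "D \<subseteq> {1..4}"
  let ?U = "Pow {1..4 :: nat}"
  have fin: "finite A" if "A \<in> ?U" for A
    using that finite_subset by blast
  \<comment> \<open>The contribution of blades \<open>A\<close>, \<open>B\<close> and the third
    blade forced by \<open>D\<close>, with all three pairwise signs. It favours neither bracketing,
    so both sides can be brought to the double sum of \<open>T\<close>.\<close>
  define T where "T A B = blade_sign A B * blade_sign A (sym_diff (sym_diff A B) D)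
    * blade_sign B (sym_diff (sym_diff A B) D)
    * coeff x A * coeff y B * coeff z (sym_diff (sym_diff A B) D)" for A B
  have sub: "sym_diff A B \<in> ?U" if "A \<in> ?U" "B \<in> ?U" for A B :: "nat set"
    using that by blast
  have DU: "D \<in> ?U" using D by simp
  have "coeff (x * y * z) D = (\<Sum>C\<in>?U. \<Sum>A\<in>?U. blade_sign C (sym_diff C D)
      * (blade_sign A (sym_diff A C) * coeff x A * coeff y (sym_diff A C)) * coeff z (sym_diff C D))"
    using D by (simp add: coeff_mult sum_distrib_left sum_distrib_right)
  also have "\<dots> = (\<Sum>C\<in>?U. \<Sum>A\<in>?U. T A (sym_diff A C))"
  proof (intro sum.cong refl)
    fix C A assume CA: "C \<in> ?U" "A \<in> ?U"
    \<comment> \<open>Here \<open>C\<close> is the blade taken from \<open>x * y\<close>. Rewriting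
      it as a symmetric difference lets its sign split into the two factors in
      \<open>T\<close>.\<close>
    have e: "sym_diff A (sym_diff A C) = C" by blast
    have "blade_sign (sym_diff A (sym_diff A C)) (sym_diff C D)
        = blade_sign A (sym_diff C D) * blade_sign (sym_diff A C) (sym_diff C D)"
      by (intro blade_sign_sym_diff_left fin sub CA DU)
    then show "blade_sign C (sym_diff C D)
      * (blade_sign A (sym_diff A C) * coeff x A * coeff y (sym_diff A C)) * coeff z (sym_diff C D)
      = T A (sym_diff A C)"
      unfolding T_def e by simp
  qed
  also have "\<dots> = (\<Sum>A\<in>?U. \<Sum>C\<in>?U. T A (sym_diff A C))"
    by (rule sum.swap)
  also have "\<dots> = (\<Sum>A\<in>?U. \<Sum>B\<in>?U. T A B)"
  proof (rule sum.cong[OF refl])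
    fix A assume A: "A \<in> ?U"
    show "(\<Sum>C\<in>?U. T A (sym_diff A C)) = (\<Sum>B\<in>?U. T A B)"
      \<comment> \<open>\<open>sym_diff A\<close> is an involution of the index set, hence its own
        inverse.\<close>
      by (rule sum.reindex_bij_witness[where i = "sym_diff A" and j = "sym_diff A"])
        (use A in blast)+
  qed
  also have "\<dots> = (\<Sum>A\<in>?U. \<Sum>B\<in>?U. blade_sign A (sym_diff A D) * coeff x A
      * (blade_sign B (sym_diff B (sym_diff A D)) * coeff y B * coeff z (sym_diff B (sym_diff A D))))"
  proof (intro sum.cong refl)
    fix A B assume AB: "A \<in> ?U" "B \<in> ?U"
    have e: "sym_diff B (sym_diff A D) = sym_diff (sym_diff A B) D" by blast
    have e': "sym_diff B (sym_diff (sym_diff A B) D) = sym_diff A D" by blast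
    have "blade_sign A (sym_diff B (sym_diff (sym_diff A B) D))
        = blade_sign A B * blade_sign A (sym_diff (sym_diff A B) D)"
      by (intro blade_sign_sym_diff_right fin sub AB DU)
    then show "T A B = blade_sign A (sym_diff A D) * coeff x A
      * (blade_sign B (sym_diff B (sym_diff A D)) * coeff y B * coeff z (sym_diff B (sym_diff A D)))"
      unfolding T_def e e' by simp
  qed
  also have "\<dots> = coeff (x * (y * z)) D"
  proof -
    have "coeff (y * z) (sym_diff A D) = (\<Sum>B\<in>?U. blade_sign B (sym_diff B (sym_diff A D))
        * coeff y B * coeff z (sym_diff B (sym_diff A D)))" if "A \<in> ?U" for A
      using sub[OF that DU] by (intro coeff_mult) simp
    then show ?thesis
      using D by (simp add: coeff_mult[of D] sum_distrib_left)
  qed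
  finally show "coeff (x * y * z) D = coeff (x * (y * z)) D" .
qed

section \<open>Products with blades and with complex scalars\<close>

definition blade :: "nat set \<Rightarrow> cl4" where
  "blade A = mk (\<lambda>B. if B = A then 1 else 0)"

lemma coeff_blade: "A \<subseteq> {1..4} \<Longrightarrow> coeff (blade A) B = (if B = A then 1 else 0)"
  by (auto simp: blade_def coeff_mk)

lemma coeff_mult_blade:
  assumes "B \<subseteq> {1..4}" "C \<subseteq> {1..4}"
  shows "coeff (x * blade B) C = blade_sign (sym_diff C B) B * coeff x (sym_diff C B)"
proof -
  have "coeff (x * blade B) C
      = (\<Sum>A\<in>Pow {1..4}. if A = sym_diff C B then blade_sign A B * coeff x A else 0)"
    unfolding coeff_mult[OF assms(2)]
  proof (intro sum.cong refl)
    fix A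
    have "sym_diff A C = B \<longleftrightarrow> A = sym_diff C B" by blast
    then show "blade_sign A (sym_diff A C) * coeff x A * coeff (blade B) (sym_diff A C)
        = (if A = sym_diff C B then blade_sign A B * coeff x A else 0)"
      by (auto simp: coeff_blade[OF assms(1)])
  qed
  also have "\<dots> = blade_sign (sym_diff C B) B * coeff x (sym_diff C B)"
    using assms by (subst sum.delta) auto
  finally show ?thesis .
qed

lemma blade_sign_empty [simp]: "blade_sign {} B = 1" "blade_sign A {} = 1"
  by (simp_all add: blade_sign_def)

lemma coeff_scal: "coeff (scal c) A = (if A = {} then c else 0)"
  by (simp add: scal_def coeff_mk)

text \<open>Turns scalar multiplication into a ring product, so that later computations need only
  ring identities and the centrality of \<open>scal c\<close>.\<close>

lemma scal_mult: "scal c * x = smul c x"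
proof (rule cl4_eqI)
  fix C :: "nat set" assume C: "C \<subseteq> {1..4}"
  have "coeff (scal c * x) C = (\<Sum>A\<in>Pow {1..4 :: nat}. if A = {} then c * coeff x C else 0)"
    unfolding coeff_mult[OF C] by (intro sum.cong) (auto simp: coeff_scal)
  then show "coeff (scal c * x) C = coeff (smul c x) C"
    by (simp add: coeff_smul)
qed

lemma one_eq_blade: "1 = blade {}"
  by (simp add: one_cl4_def blade_def)

lemma scal_1: "scal 1 = 1"
  by (simp add: scal_def one_cl4_def)

instance cl4 :: ring_1
proof
  fix a b c :: cl4
  show "a * b * c = a * (b * c)"
    by (rule cl4_mult_assoc)
  show "1 * a = a"
    by (simp add: scal_mult coeff_smul cl4_eqI flip: scal_1)
  show "a * 1 = a"
    by (rule cl4_eqI) (simp add: one_eq_blade coeff_mult_blade)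
  show "0 \<noteq> (1 :: cl4)"
  proof
    assume "0 = (1 :: cl4)"
    then have "coeff 0 {} = coeff 1 {}" by (rule arg_cong)
    then show False
      by (simp add: coeff_0 one_eq_blade coeff_blade)
  qed
qed (rule cl4_eqI, simp add: coeff_0 coeff_add coeff_diff coeff_uminus coeff_mult
       algebra_simps sum.distrib)+

lemma scal_add: "scal (c + d) = scal c + scal d"
  by (rule cl4_eqI) (simp add: coeff_scal coeff_add)

lemma scal_diff: "scal (c - d) = scal c - scal d"
  by (rule cl4_eqI) (simp add: coeff_scal coeff_diff)

lemma scal_minus: "scal (- c) = - scal c"
  by (rule cl4_eqI) (simp add: coeff_scal coeff_uminus)

lemma scal_0: "scal 0 = 0"
  by (rule cl4_eqI) (simp add: coeff_scal coeff_0)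

lemma scal_times: "scal (c * d) = scal c * scal d"
  by (rule cl4_eqI) (simp add: scal_mult coeff_smul coeff_scal)

lemma scal_numeral: "scal (numeral n) = numeral n"
  by (induction n) (simp_all only: numeral.simps scal_add scal_1)

text \<open>\<open>scal c\<close> lives on the empty blade, whose sign with every blade is 1 on
  either side.\<close>

lemma scal_commute: "x * scal c = scal c * x"
proof (rule cl4_eqI)
  fix C :: "nat set" assume C: "C \<subseteq> {1..4}"
  have "coeff (x * scal c) C = (\<Sum>A\<in>Pow {1..4}. if A = C then c * coeff x C else 0)"
    unfolding coeff_mult[OF C]
  proof (intro sum.cong refl)
    fix A
    have "sym_diff A C = {} \<longleftrightarrow> A = C" by blast
    then show "blade_sign A (sym_diff A C) * coeff x A * coeff (scal c) (sym_diff A C)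
        = (if A = C then c * coeff x C else 0)"
      by (auto simp: coeff_scal)
  qed
  then show "coeff (x * scal c) C = coeff (scal c * x) C"
    using C by (simp add: scal_mult coeff_smul)
qed

text \<open>The multiplication law of a twisted group algebra. It reduces every identity between
  blades to a sign and a symmetric difference.\<close>

lemma blade_mult:
  assumes "A \<subseteq> {1..4}" "B \<subseteq> {1..4}"
  shows "blade A * blade B = scal (blade_sign A B) * blade (sym_diff A B)"
proof (rule cl4_eqI)
  fix C :: "nat set" assume C: "C \<subseteq> {1..4}"
  have "sym_diff C B = A \<longleftrightarrow> C = sym_diff A B" by blast
  moreover have "sym_diff A B \<subseteq> {1..4}" using assms by blast
  ultimately show "coeff (blade A * blade B) C
      = coeff (scal (blade_sign A B) * blade (sym_diff A B)) C"
    using assms C by (auto simp: coeff_mult_blade coeff_blade scal_mult coeff_smul)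
qed

lemma gen_eq_blade: "gen j = blade {j}"
  by (simp add: gen_def blade_def)

lemma gen_square: "j \<in> {1..4} \<Longrightarrow> gen j * gen j = -1"
  by (simp add: gen_eq_blade blade_mult blade_sign_eq_prod scal_minus scal_1 flip: one_eq_blade)

lemma gen_anticommute:
  assumes "j \<in> {1..4}" "k \<in> {1..4}" "j \<noteq> k"
  shows "gen j * gen k = - (gen k * gen j)"
proof -
  have "sym_diff {j} {k} = sym_diff {k} {j}" by blast
  with assms show ?thesis
    \<comment> \<open>Exactly one of the two orders has an inversion, and which one depends on the
      order of \<open>j\<close> and \<open>k\<close>.\<close>
    by (cases j k rule: linorder_cases)
      (simp_all add: gen_eq_blade blade_mult blade_sign_eq_prod scal_minus scal_1)
qed

section \<open>The subalgebra and its commutant\<close>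

lemma e12_eq_blade: "e12 = blade {1, 2}"
  by (simp add: e12_def gen_eq_blade blade_mult blade_sign_eq_prod scal_1 insert_commute)

lemma e123_eq_blade: "e123 = blade {1, 2, 3}"
  \<comment> \<open>The simplifier turns \<open>1\<close> into \<open>Suc 0\<close>, so the product
    of the first two generators is supplied in that form.\<close>
  by (simp add: e123_def e12_eq_blade[unfolded e12_def One_nat_def] gen_eq_blade[of 3] blade_mult
      blade_sign_eq_prod scal_1 insert_commute)

lemma e124_eq_blade: "e124 = blade {1, 2, 4}"
  by (simp add: e124_def e12_eq_blade[unfolded e12_def One_nat_def] gen_eq_blade[of 4] blade_mult
      blade_sign_eq_prod scal_1 insert_commute)

lemma e123_square: "e123 * e123 = 1"
  by (simp add: e123_eq_blade blade_mult blade_sign_eq_prod scal_1 flip: one_eq_blade)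

lemma e124_square: "e124 * e124 = 1"
  by (simp add: e124_eq_blade blade_mult blade_sign_eq_prod scal_1 flip: one_eq_blade)

lemma e123_e124: "e123 * e124 = - blade {3, 4}"
proof -
  have "sym_diff {1, 2, 3} {1, 2, 4} = {3, 4 :: nat}" by auto
  then show ?thesis
    by (simp add: e123_eq_blade e124_eq_blade blade_mult blade_sign_eq_prod scal_1 scal_minus)
qed

lemma e124_e123: "e124 * e123 = blade {3, 4}"
proof -
  have "sym_diff {1, 2, 4} {1, 2, 3} = {3, 4 :: nat}" by auto
  then show ?thesis
    by (simp add: e123_eq_blade e124_eq_blade blade_mult blade_sign_eq_prod scal_1 scal_minus)
qed

lemma e43_eq_blade: "e43 = - blade {3, 4}"
  by (simp add: e43_def gen_eq_blade blade_mult blade_sign_eq_prod scal_1 scal_minus insert_commute)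

lemma C2_eq_sum:
  assumes "b \<in> C2"
  shows "b = scal (coeff b {}) + scal (coeff b {1}) * gen 1
             + scal (coeff b {2}) * gen 2 + scal (coeff b {1, 2}) * e12"
proof (rule cl4_eqI)
  fix A :: "nat set"
  have *: "{Suc 0} \<noteq> {2}" "{2} \<noteq> {Suc 0}" "{Suc 0, 2} \<noteq> {2}" "{2} \<noteq> {Suc 0, 2}"
    by auto
  have "Pow {1, 2 :: nat} = {{}, {1}, {2}, {1, 2}}"
    unfolding Pow_insert Pow_empty by (simp add: insert_commute)
  then consider "\<not> A \<subseteq> {1, 2}" | "A = {}" | "A = {1}" | "A = {2}" | "A = {1, 2}"
    unfolding Pow_iff[symmetric] by (metis empty_iff insert_iff)
  then show "coeff b A = coeff (scal (coeff b {}) + scal (coeff b {1}) * gen 1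
      + scal (coeff b {2}) * gen 2 + scal (coeff b {1, 2}) * e12) A"
    using assms
    by cases (auto simp: coeff_add scal_mult coeff_smul coeff_scal gen_eq_blade e12_eq_blade
        coeff_blade C2_def *)
qed

lemma
  shows one_in_C2: "1 \<in> C2" and gen1_in_C2: "gen 1 \<in> C2" and gen2_in_C2: "gen 2 \<in> C2"
    and e12_in_C2: "e12 \<in> C2" and zero_in_C2: "0 \<in> C2"
  by (auto simp: C2_def one_eq_blade gen_eq_blade e12_eq_blade coeff_blade coeff_0)

lemma C2_add: "x \<in> C2 \<Longrightarrow> y \<in> C2 \<Longrightarrow> x + y \<in> C2"
  by (simp add: C2_def coeff_add)

lemma C2_diff: "x \<in> C2 \<Longrightarrow> y \<in> C2 \<Longrightarrow> x - y \<in> C2"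
  by (simp add: C2_def coeff_diff)

lemma C2_uminus: "x \<in> C2 \<Longrightarrow> - x \<in> C2"
  by (simp add: C2_def coeff_uminus)

lemma C2_smul: "x \<in> C2 \<Longrightarrow> smul c x \<in> C2"
  by (simp add: C2_def coeff_smul)

text \<open>Commuting with the two generators passes to their product and to complex combinations,
  hence to all of \<open>C2\<close>.\<close>

lemma blade_commute_C2:
  assumes "B \<subseteq> {1..4}" "b \<in> C2"
    and "gen 1 * blade B = blade B * gen 1" "gen 2 * blade B = blade B * gen 2"
  shows "b * blade B = blade B * b"
proof -
  have "e12 * blade B = blade B * e12"
    unfolding e12_def by (metis assms(3,4) mult.assoc)
  then have *: "scal c * gen 1 * blade B = blade B * (scal c * gen 1)"
    "scal c * gen 2 * blade B = blade B * (scal c * gen 2)"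
    "scal c * e12 * blade B = blade B * (scal c * e12)" for c
    using assms(3,4) by (metis mult.assoc scal_commute)+
  show ?thesis
    by (subst (1 2) C2_eq_sum[OF assms(2)]) (simp only: distrib_left distrib_right * scal_commute)
qed

text \<open>Moving \<open>gen 1\<close> or \<open>gen 2\<close> past \<open>e123\<close> crosses
  exactly two other generators, whose signs cancel. The same count works for
  \<open>e124\<close>.\<close>

lemma e123_commute_C2: "b \<in> C2 \<Longrightarrow> b * e123 = e123 * b"
  unfolding e123_eq_blade
  by (rule blade_commute_C2)
    (simp_all add: gen_eq_blade blade_mult blade_sign_eq_prod insert_commute insert_Diff_if)

lemma e124_commute_C2: "b \<in> C2 \<Longrightarrow> b * e124 = e124 * b"
  unfolding e124_eq_blade
  by (rule blade_commute_C2)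
    (simp_all add: gen_eq_blade blade_mult blade_sign_eq_prod insert_commute insert_Diff_if)

lemma e43_eq: "e43 = e123 * e124"
  by (simp add: e43_eq_blade e123_e124)

lemma e43_commute_C2: "b \<in> C2 \<Longrightarrow> b * e43 = e43 * b"
  unfolding e43_eq by (metis e123_commute_C2 e124_commute_C2 mult.assoc)

lemma e43_square: "e43 * e43 = -1"
  by (simp add: e43_eq_blade blade_mult blade_sign_eq_prod scal_1 scal_minus flip: one_eq_blade)

text \<open>The four summands are the parts of \<open>a\<close> on blades \<open>A\<close> with a fixed \<open>A \<inter> {3, 4}\<close>; each is
  divided by \<open>e123\<close>, \<open>e124\<close> or \<open>e43\<close>, whose squares are \<open>\<plusminus>1\<close>.\<close>
lemma decomposition_ex:
  "\<exists>a0\<in>C2. \<exists>a1\<in>C2. \<exists>a2\<in>C2. \<exists>a3\<in>C2. a = a0 + a1 * e123 + a2 * e124 + a3 * e43"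
proof -
  define part where "part S = mk (\<lambda>A. if A \<inter> {3, 4} = S then coeff a A else 0)" for S
  have coeff_part: "coeff (part S) A = (if A \<inter> {3, 4} = S then coeff a A else 0)" for S A
    by (auto simp: part_def coeff_mk coeff_outside)
  \<comment> \<open>A blade with the same trace \<open>S\<close> on \<open>{3, 4}\<close> cancels
    that trace, so only blades inside \<open>{1, 2}\<close> survive.\<close>
  have part_mult: "part S * blade B \<in> C2" if B: "B \<subseteq> {1..4}" "B \<inter> {3, 4} = S" for B S
    unfolding C2_def
  proof (intro CollectI allI impI)
    fix A :: "nat set" assume A: "\<not> A \<subseteq> {1, 2}"
    show "coeff (part S * blade B) A = 0"
    proof (cases "A \<subseteq> {1..4}")
      case True
      have "{1..4} = {1, 2, 3, 4 :: nat}" by auto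
      with True A obtain k where "k \<in> A" "k \<in> {3, 4}" by auto
      then have "sym_diff A B \<inter> {3, 4} \<noteq> S" using B(2) by blast
      with B True show ?thesis by (simp add: coeff_mult_blade coeff_part)
    qed (rule coeff_outside)
  qed
  have "a = part {} + part {3} + part {4} + part {3, 4}"
  proof (rule cl4_eqI)
    fix A :: "nat set"
    have *: "{3} \<noteq> {4 :: nat}" "{4} \<noteq> {3 :: nat}" "{3, 4} \<noteq> {3 :: nat}" "{3, 4} \<noteq> {4 :: nat}"
       "{3} \<noteq> {3, 4 :: nat}" "{4} \<noteq> {3, 4 :: nat}"
      by auto
    consider "A \<inter> {3, 4} = {}" | "A \<inter> {3, 4} = {3}" | "A \<inter> {3, 4} = {4}" | "A \<inter> {3, 4} = {3, 4}"
      by blast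
    then show "coeff a A = coeff (part {} + part {3} + part {4} + part {3, 4}) A"
      by cases (simp_all add: coeff_add coeff_part *)
  qed
  \<comment> \<open>Each pair of equal factors restores the part; the last witness carries a minus
    sign because \<open>e43\<close> squares to -1.\<close>
  then have "a = part {} + part {3} * e123 * e123 + part {4} * e124 * e124 + (- (part {3, 4} * e43)) * e43"
    by (simp add: mult.assoc e123_square e124_square e43_square)
  moreover have "part {} \<in> C2"
    using part_mult[of "{}" "{}"] by (simp flip: one_eq_blade)
  moreover have "part {3} * e123 \<in> C2" "part {4} * e124 \<in> C2"
    unfolding e123_eq_blade e124_eq_blade by (rule part_mult; auto)+
  moreover have "- (part {3, 4} * e43) \<in> C2"
    unfolding e43_eq_blade using part_mult[of "{3, 4}" "{3, 4}"] by simp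
  ultimately show ?thesis by blast
qed

section \<open>The conjugations by the two kinds of blocks\<close>

text \<open>To be used with \<open>x = gen 1\<close>, \<open>y = gen 2\<close> and
  \<open>I = scal \<i>\<close>, where \<open>Q\<close> is twice \<open>P2\<close>. The right-hand
  sides are 4 times the \<open>phi2\<close> matrices of the basis 1, \<open>x\<close>,
  \<open>y\<close>, \<open>x * y\<close>. Over an abstract ring only the relations enter, and these
  give a normal form with \<open>I\<close> before \<open>x\<close> before \<open>y\<close>.\<close>

lemma quaternion_block_sandwich:
  fixes x y I :: "'a :: ring_1" and Q :: "nat \<Rightarrow> nat \<Rightarrow> 'a"
  assumes x: "x * x = -1" and y: "y * y = -1" and yx: "y * x = - (x * y)"
    and I: "I * I = -1" and xI: "x * I = I * x" and yI: "y * I = I * y"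
    and Q: "\<And>u v. Q u v = (if u = 0 \<and> v = 0 then 1 - I * x
      else if u = 0 \<and> v = 1 then y + I * (x * y)
      else if u = 1 \<and> v = 0 then - y + I * (x * y) else 1 + I * x)"
    and uv: "u < 2" "v < 2"
  shows "Q u 0 * 1 * Q 0 v + Q u 1 * 1 * Q 1 v = 4 * (if u = v then 1 else 0)"
    and "Q u 0 * x * Q 0 v + Q u 1 * x * Q 1 v
      = 4 * (if u = v then if u = 0 then I else - I else 0)"
    and "Q u 0 * y * Q 0 v + Q u 1 * y * Q 1 v
      = 4 * (if u = v then 0 else if u = 0 then -1 else 1)"
    and "Q u 0 * (x * y) * Q 0 v + Q u 1 * (x * y) * Q 1 v
      = 4 * (if u = v then 0 else - I)"
proof -
  \<comment> \<open>The relations with a trailing factor, so that they also rewrite inside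
    right-nested products.\<close>
  have rules: "x * (x * z) = - z" "y * (y * z) = - z" "I * (I * z) = - z"
    "y * (x * z) = - (x * (y * z))" "x * (I * z) = I * (x * z)" "y * (I * z) = I * (y * z)" for z
    using assms(1-6) by (simp_all flip: mult.assoc)
  have four: "4 * z = z + z + z + z" for z :: 'a
  proof -
    have "(4 :: 'a) = 1 + 1 + 1 + 1" by simp
    then show ?thesis by (simp only: distrib_right mult_1_left)
  qed
  have cases: "u = 0 \<or> u = 1" "v = 0 \<or> v = 1" using uv by auto
  show "Q u 0 * 1 * Q 0 v + Q u 1 * 1 * Q 1 v = 4 * (if u = v then 1 else 0)"
    "Q u 0 * x * Q 0 v + Q u 1 * x * Q 1 v
      = 4 * (if u = v then if u = 0 then I else - I else 0)"
    "Q u 0 * y * Q 0 v + Q u 1 * y * Q 1 v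
      = 4 * (if u = v then 0 else if u = 0 then -1 else 1)"
    "Q u 0 * (x * y) * Q 0 v + Q u 1 * (x * y) * Q 1 v
      = 4 * (if u = v then 0 else - I)"
    using cases
    by (auto simp: Q algebra_simps four rules assms(1-6))
qed

text \<open>To be used with \<open>e = e123\<close> and \<open>f = e124\<close>, so that
  \<open>e * f\<close> is \<open>e43\<close>. Up to the factor 4, the right-hand sides are the block
  sign patterns of \<open>a0\<close>, \<open>a1\<close>, \<open>a2\<close>, \<open>a3\<close> in
  \<open>rhs4\<close>.\<close>

lemma involution_block_sandwich:
  fixes e f :: "'a :: ring_1" and B :: "nat \<Rightarrow> nat \<Rightarrow> 'a"
  assumes e: "e * e = 1" and f: "f * f = 1" and fe: "f * e = - (e * f)"
    and B: "\<And>p q. B p q = (if p = 0 \<and> q = 0 then 1 + e else if p = 0 \<and> q = 1 then f - e * f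
      else if p = 1 \<and> q = 0 then f + e * f else 1 - e)"
    and pq: "p < 2" "q < 2"
  shows "B p 0 * 1 * B 0 q + B p 1 * 1 * B 1 q = 4 * (if p = q then 1 else 0)"
    and "B p 0 * e * B 0 q + B p 1 * e * B 1 q
      = 4 * (if p = q then if p = 0 then 1 else -1 else 0)"
    and "B p 0 * f * B 0 q + B p 1 * f * B 1 q = 4 * (if p = q then 0 else 1)"
    and "B p 0 * (e * f) * B 0 q + B p 1 * (e * f) * B 1 q
      = 4 * (if p = q then 0 else if p = 0 then 1 else -1)"
proof -
  have rules: "e * (e * z) = z" "f * (f * z) = z" "f * (e * z) = - (e * (f * z))" for z
    using e f fe by (simp_all flip: mult.assoc)
  have four: "4 * z = z + z + z + z" for z :: 'a
  proof -
    have "(4 :: 'a) = 1 + 1 + 1 + 1" by simp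
    then show ?thesis by (simp only: distrib_right mult_1_left)
  qed
  have cases: "p = 0 \<or> p = 1" "q = 0 \<or> q = 1" using pq by auto
  show "B p 0 * 1 * B 0 q + B p 1 * 1 * B 1 q = 4 * (if p = q then 1 else 0)"
    "B p 0 * e * B 0 q + B p 1 * e * B 1 q
      = 4 * (if p = q then if p = 0 then 1 else -1 else 0)"
    "B p 0 * f * B 0 q + B p 1 * f * B 1 q = 4 * (if p = q then 0 else 1)"
    "B p 0 * (e * f) * B 0 q + B p 1 * (e * f) * B 1 q
      = 4 * (if p = q then 0 else if p = 0 then 1 else -1)"
    using cases
    by (auto simp: B algebra_simps four rules e f fe)
qed

section \<open>Conjugation of \<open>C2\<close> by \<open>P2\<close>\<close>

lemma P2_eq:
  "P2 u v = scal (1/2) * (if u = 0 \<and> v = 0 then 1 - scal \<i> * gen 1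
     else if u = 0 \<and> v = 1 then gen 2 + scal \<i> * (gen 1 * gen 2)
     else if u = 1 \<and> v = 0 then - gen 2 + scal \<i> * (gen 1 * gen 2)
     else 1 + scal \<i> * gen 1)"
  by (simp add: P2_def e12_def scal_mult)

lemma scal_half_mult_half: "scal (1/2) * x * y * (scal (1/2) * z) = scal (1/4) * (x * y * z)"
proof -
  have "scal (1/2) * x * y * (scal (1/2) * z) = scal (1/2) * (x * y * scal (1/2)) * z"
    by (simp only: mult.assoc)
  also have "\<dots> = scal (1/2) * scal (1/2) * (x * y * z)"
    unfolding scal_commute[of "x * y"] by (simp only: mult.assoc)
  also have "scal (1/2) * scal (1/2) = scal (1/4)"
    by (simp flip: scal_times)
  finally show ?thesis .
qed

lemma scal_quarter_cancel: "scal (1/4) * (4 * x) = x"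
proof -
  have "scal (1/4) * (4 * x) = scal (1/4 * 4) * x"
    by (simp only: scal_times scal_numeral mult.assoc)
  then show ?thesis by (simp add: scal_1)
qed

text \<open>Both sides are complex linear in \<open>b\<close>, so the four basis values of the block
  computation suffice; the two factors 1/2 from \<open>P2\<close> cancel its 4.\<close>

lemma P2_sandwich:
  assumes b: "b \<in> C2" and uv: "u < 2" "v < 2"
  shows "P2 u 0 * b * P2 0 v + P2 u 1 * b * P2 1 v = scal (phi2 b u v)"
proof -
  define Q where "Q u v = (if u = 0 \<and> v = 0 then 1 - scal \<i> * gen 1
     else if u = 0 \<and> v = 1 then gen 2 + scal \<i> * (gen 1 * gen 2)
     else if u = 1 \<and> v = 0 then - gen 2 + scal \<i> * (gen 1 * gen 2)
     else 1 + scal \<i> * gen 1)" for u v :: nat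
  define L where "L z = Q u 0 * z * Q 0 v + Q u 1 * z * Q 1 v" for z
  have P2: "P2 u v = scal (1/2) * Q u v" for u v
    unfolding Q_def by (rule P2_eq)
  have "gen 1 * gen 1 = -1" "gen 2 * gen 2 = -1" "gen 2 * gen 1 = - (gen 1 * gen 2)"
    "scal \<i> * scal \<i> = -1"
    by (simp_all add: gen_square gen_anticommute[of 2 1] scal_minus scal_1 flip: scal_times del: One_nat_def)
  note block = quaternion_block_sandwich[OF this scal_commute scal_commute Q_def uv, folded L_def]
  have L_scal: "L (scal c * z) = scal c * L z" for c z
  proof -
    have "x * (scal c * z) * y = scal c * (x * z * y)" for x y
      by (metis mult.assoc scal_commute)
    then show ?thesis by (simp add: L_def distrib_left)
  qed
  have L_add: "L (y + z) = L y + L z" for y z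
    by (simp add: L_def distrib_left distrib_right)
  have "P2 u 0 * b * P2 0 v + P2 u 1 * b * P2 1 v = scal (1/4) * L b"
    by (simp only: P2 scal_half_mult_half L_def distrib_left)
  also have "L b = L (scal (coeff b {}) * 1 + scal (coeff b {1}) * gen 1
             + scal (coeff b {2}) * gen 2 + scal (coeff b {1, 2}) * (gen 1 * gen 2))"
    using C2_eq_sum[OF b] by (simp add: e12_def)
  also have "\<dots> = scal (coeff b {}) * L 1 + scal (coeff b {1}) * L (gen 1)
             + scal (coeff b {2}) * L (gen 2) + scal (coeff b {1, 2}) * L (gen 1 * gen 2)"
    by (simp only: L_add L_scal)
  also have "\<dots> = 4 * scal (phi2 b u v)"
  proof -
    have comm: "x * (4 * y) = 4 * (x * y)" for x y :: cl4
      by (metis mult.assoc scal_commute scal_numeral)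
    have "u = 0 \<or> u = 1" "v = 0 \<or> v = 1" using uv by auto
    then show ?thesis
      unfolding block comm distrib_left[symmetric]
      by (elim disjE) (simp_all add: phi2_def scal_add scal_diff scal_minus scal_times)
  qed
  finally show ?thesis by (simp only: scal_quarter_cancel)
qed

section \<open>Conjugation by \<open>P4\<close>\<close>

lemma P2_in_C2: "P2 u v \<in> C2"
  unfolding P2_def
  by (intro C2_smul) (auto intro!: C2_add C2_diff C2_uminus C2_smul one_in_C2 gen1_in_C2[simplified] gen2_in_C2 e12_in_C2)

lemma B4_commute_C2: "b \<in> C2 \<Longrightarrow> b * B4 p q = B4 p q * b"
  by (simp add: B4_def distrib_left distrib_right left_diff_distrib right_diff_distrib
      e123_commute_C2 e124_commute_C2 e43_commute_C2)

text \<open>Entries of \<open>P2\<close> commute with \<open>E\<close> and with entries of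
  \<open>B4\<close>, and \<open>b\<close> commutes with entries of \<open>B4\<close>. Each summand
  therefore regroups into an outer word around \<open>E\<close> times an inner word around
  \<open>b\<close>.\<close>

lemma P4_sandwich:
  assumes b: "b \<in> C2" and E: "\<And>c. c \<in> C2 \<Longrightarrow> c * E = E * c"
  shows "mmult (mmult P4 (diag4 (E * b))) P4 i j
    = scal (1/4) * ((B4 (i div 2) 0 * E * B4 0 (j div 2) + B4 (i div 2) 1 * E * B4 1 (j div 2))
        * (P2 (i mod 2) 0 * b * P2 0 (j mod 2) + P2 (i mod 2) 1 * b * P2 1 (j mod 2)))"
proof -
  have summand: "P4 i k * (E * b) * P4 k j
    = scal (1/4) * ((B4 (i div 2) (k div 2) * E * B4 (k div 2) (j div 2))
        * (P2 (i mod 2) (k mod 2) * b * P2 (k mod 2) (j mod 2)))" for k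
  proof -
    let ?B = "B4 (i div 2) (k div 2)" and ?B' = "B4 (k div 2) (j div 2)"
    let ?P = "P2 (i mod 2) (k mod 2)" and ?P' = "P2 (k mod 2) (j mod 2)"
    have "P4 i k * (E * b) * P4 k j = scal (1/4) * (?B * ?P * (E * b) * (?B' * ?P'))"
      unfolding P4_def scal_mult[symmetric] by (rule scal_half_mult_half)
    also have "?B * ?P * (E * b) * (?B' * ?P') = ?B * (?P * E) * (b * ?B') * ?P'"
      by (simp only: mult.assoc)
    also have "\<dots> = ?B * E * (?P * ?B') * b * ?P'"
      by (simp only: E[OF P2_in_C2] B4_commute_C2[OF b] mult.assoc)
    also have "\<dots> = ?B * E * ?B' * (?P * b * ?P')"
      by (simp only: B4_commute_C2[OF P2_in_C2] mult.assoc)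
    finally show ?thesis .
  qed
  have "mmult (mmult P4 (diag4 a)) P4 i j = P4 i 0 * a * P4 0 j + P4 i 1 * a * P4 1 j
      + P4 i 2 * a * P4 2 j + P4 i 3 * a * P4 3 j" for a
    by (simp add: mmult_def diag4_def)
  then have "mmult (mmult P4 (diag4 (E * b))) P4 i j
      = P4 i 0 * (E * b) * P4 0 j + P4 i 1 * (E * b) * P4 1 j
      + P4 i 2 * (E * b) * P4 2 j + P4 i 3 * (E * b) * P4 3 j" .
  \<comment> \<open>As \<open>k\<close> runs over 0 to 3, \<open>(k div 2, k mod 2)\<close> runs
    over all pairs of block and inner index, so the four summands are the expanded product of the
    two sums.\<close>
  then show ?thesis
    unfolding summand by (simp add: distrib_left distrib_right add.assoc add.left_commute)
qed

lemma mmult_P4_diag4_add: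
  "mmult (mmult P4 (diag4 (a + b))) P4 i j
    = mmult (mmult P4 (diag4 a)) P4 i j + mmult (mmult P4 (diag4 b)) P4 i j"
  by (simp add: mmult_def diag4_def distrib_left distrib_right add_ac)

text \<open>The right factor is \<open>P4\<close> itself, not an inverse, so nothing about
  invertibility is presupposed; \<open>P4_involution\<close> is then deduced from this
  lemma.\<close>

lemma P4_conjugation:
  assumes C2: "a0 \<in> C2" "a1 \<in> C2" "a2 \<in> C2" "a3 \<in> C2" and ij: "i < 4" "j < 4"
  shows "mmult (mmult P4 (diag4 (a0 + e123 * a1 + e124 * a2 + e43 * a3))) P4 i j
    = scal (rhs4 a0 a1 a2 a3 i j)"
proof -
  have "e124 * e123 = - (e123 * e124)"
    by (simp add: e124_e123 e123_e124)
  moreover have "i div 2 < 2" "j div 2 < 2" using ij by auto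
  ultimately have blocks:
    "B4 (i div 2) 0 * 1 * B4 0 (j div 2) + B4 (i div 2) 1 * 1 * B4 1 (j div 2)
      = 4 * (if i div 2 = j div 2 then 1 else 0)"
    "B4 (i div 2) 0 * e123 * B4 0 (j div 2) + B4 (i div 2) 1 * e123 * B4 1 (j div 2)
      = 4 * (if i div 2 = j div 2 then if i div 2 = 0 then 1 else -1 else 0)"
    "B4 (i div 2) 0 * e124 * B4 0 (j div 2) + B4 (i div 2) 1 * e124 * B4 1 (j div 2)
      = 4 * (if i div 2 = j div 2 then 0 else 1)"
    "B4 (i div 2) 0 * e43 * B4 0 (j div 2) + B4 (i div 2) 1 * e43 * B4 1 (j div 2)
      = 4 * (if i div 2 = j div 2 then 0 else if i div 2 = 0 then 1 else -1)"
    using involution_block_sandwich[OF e123_square e124_square _ B4_def[unfolded e43_eq], of "i div 2" "j div 2"]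
    unfolding e43_eq by blast+
  have uv: "i mod 2 < 2" "j mod 2 < 2" by auto
  \<comment> \<open>Gives the first summand the shape \<open>E * b\<close> with
    \<open>E = 1\<close>, like the other three.\<close>
  have "a0 = 1 * a0" by simp
  then have "mmult (mmult P4 (diag4 (a0 + e123 * a1 + e124 * a2 + e43 * a3))) P4 i j
    = mmult (mmult P4 (diag4 (1 * a0))) P4 i j + mmult (mmult P4 (diag4 (e123 * a1))) P4 i j
      + mmult (mmult P4 (diag4 (e124 * a2))) P4 i j + mmult (mmult P4 (diag4 (e43 * a3))) P4 i j"
    by (simp only: mmult_P4_diag4_add)
  also have "\<dots> = (if i div 2 = j div 2 then 1 else 0) * scal (phi2 a0 (i mod 2) (j mod 2))
      + (if i div 2 = j div 2 then if i div 2 = 0 then 1 else -1 else 0) * scal (phi2 a1 (i mod 2) (j mod 2))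
      + (if i div 2 = j div 2 then 0 else 1) * scal (phi2 a2 (i mod 2) (j mod 2))
      + (if i div 2 = j div 2 then 0 else if i div 2 = 0 then 1 else -1) * scal (phi2 a3 (i mod 2) (j mod 2))"
    using C2 e123_commute_C2 e124_commute_C2 e43_commute_C2
    by (subst (1 2 3 4) P4_sandwich)
      (simp_all only: mult_1_left mult_1_right ij blocks blocks(1)[unfolded mult_1_right] P2_sandwich uv mult.assoc[of 4] scal_quarter_cancel)
  also have "\<dots> = scal (rhs4 a0 a1 a2 a3 i j)"
  proof -
    have "i div 2 = 0 \<or> i div 2 = 1" "j div 2 = 0 \<or> j div 2 = 1" using ij by auto
    then show ?thesis
      by (elim disjE) (simp_all add: rhs4_def Let_def scal_add scal_diff)
  qed
  finally show ?thesis .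
qed

lemma P4_involution:
  assumes "i < 4" "j < 4"
  shows "mmult P4 P4 i j = I4 i j"
proof -
  \<comment> \<open>The zero summands make the identity matrix an instance of the conjugation
    formula.\<close>
  have "mmult P4 P4 i j = mmult (mmult P4 (diag4 (1 + e123 * 0 + e124 * 0 + e43 * 0))) P4 i j"
    by (simp add: mmult_def diag4_def)
  also have "\<dots> = scal (rhs4 1 0 0 0 i j)"
    by (intro P4_conjugation one_in_C2 zero_in_C2 assms)
  also have "\<dots> = I4 i j"
  proof -
    have "i = 0 \<or> i = 1 \<or> i = 2 \<or> i = 3" "j = 0 \<or> j = 1 \<or> j = 2 \<or> j = 3"
      using assms by auto
    then show ?thesis
      by (elim disjE) (simp_all add: rhs4_def phi2_def diag4_def coeff_0 one_eq_blade coeff_blade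
          scal_0 scal_1[unfolded one_eq_blade])
  qed
  finally show ?thesis .
qed

theorem theorem13:
  shows "e123 * e123 = 1 \<and> e124 * e124 = 1 \<and> e43 = e123 * e124 \<and> e43 = - (e124 * e123)
    \<and> (\<forall>a. \<exists>a0\<in>C2. \<exists>a1\<in>C2. \<exists>a2\<in>C2. \<exists>a3\<in>C2.
           a = a0 + a1 * e123 + a2 * e124 + a3 * e43 \<and>
           a = a0 + e123 * a1 + e124 * a2 + e43 * a3)
    \<and> invertible4 P4
    \<and> (\<forall>i<4. \<forall>j<4. mmult P4 P4 i j = I4 i j)
    \<and> (\<forall>a a0 a1 a2 a3. a0 \<in> C2 \<longrightarrow> a1 \<in> C2 \<longrightarrow> a2 \<in> C2 \<longrightarrow> a3 \<in> C2 \<longrightarrow>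
         a = a0 + e123 * a1 + e124 * a2 + e43 * a3 \<longrightarrow>
         (\<forall>i<4. \<forall>j<4. mmult (mmult P4 (diag4 a)) P4 i j = scal (rhs4 a0 a1 a2 a3 i j)))"
proof (intro conjI allI impI)
  show "e43 = - (e124 * e123)"
    by (simp add: e43_eq_blade e124_e123)
  show "invertible4 P4"
    unfolding invertible4_def using P4_involution by blast
  fix a
  show "\<exists>a0\<in>C2. \<exists>a1\<in>C2. \<exists>a2\<in>C2. \<exists>a3\<in>C2.
           a = a0 + a1 * e123 + a2 * e124 + a3 * e43 \<and>
           a = a0 + e123 * a1 + e124 * a2 + e43 * a3"
    \<comment> \<open>The same coefficients serve on both sides because they commute with
      \<open>e123\<close>, \<open>e124\<close> and \<open>e43\<close>.\<close>
    using decomposition_ex[of a] by (metis e123_commute_C2 e124_commute_C2 e43_commute_C2)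
qed (simp_all only: e123_square e124_square e43_eq P4_involution P4_conjugation[unfolded e43_eq])

end
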